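(* Let $G=(V,E)$ be a graph of treewidth $t$, let $c:V\to\{\mathbf r,\mathbf b\}$ be a 2-colouring, and let $\mathcal H$ be a non-piercing family of subgraphs of $G$. Then $(G,\mathcal H)$ admits a primal support $Q$ with $\mathrm{tw}(Q)\le 2^{t+2}+t$.
   Context: All graphs are finite and simple. A subgraph $H$ of a graph $G$ is identified with its vertex set $V(H)$ (subgraphs are taken to be induced), and intersections, differences and containments of subgraphs refer to their vertex sets. A family $\mathcal H$ of subgraphs of $G$ is non-piercing if every $H\in\mathcal H$ induces a connected subgraph of $G$ and, for all $H,H'\in\mathcal H$, the induced subgraph $G[V(H)\setminus V(H')]$ is connected (an empty vertex set is regarded as connected). The 2-colouring $c$ need not be proper; $\mathbf b(V)=c^{-1}(\mathbf b)$ and $\mathbf b(H)=V(H)\cap\mathbf b(V)$. A primal support for $(G,\mathcal H)$ is a graph $Q$ with vertex set $\mathbf b(V)$ such that $Q[\mathbf b(H)]$ is connected for every $H\in\mathcal H$. $\mathrm{tw}$ denotes treewidth. *)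

theory Defs
  imports Main
begin

text \<open>A finite simple graph: finite vertex set V and a set E of 2-element subsets of V.\<close>
definition simple_graph :: "'a set \<Rightarrow> 'a set set \<Rightarrow> bool" where
  "simple_graph V E \<longleftrightarrow> finite V \<and>
     (\<forall>e\<in>E. \<exists>u v. e = {u, v} \<and> u \<noteq> v \<and> u \<in> V \<and> v \<in> V)"

text \<open>Adjacency inside a vertex set S (edges of the induced subgraph G[S]).\<close>
definition induced_adj :: "'a set set \<Rightarrow> 'a set \<Rightarrow> ('a \<times> 'a) set" where
  "induced_adj E S = {(u, v). {u, v} \<in> E \<and> u \<in> S \<and> v \<in> S}"

text \<open>S induces a connected subgraph (the empty set counts as connected).\<close>
definition connected_in :: "'a set set \<Rightarrow> 'a set \<Rightarrow> bool" where
  "connected_in E S \<longleftrightarrow> (\<forall>u\<in>S. \<forall>v\<in>S. (u, v) \<in> (induced_adj E S)\<^sup>*)"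

text \<open>A (finite) tree on node set N with edge set TE: a nonempty connected graph
  with |TE| = |N| - 1.\<close>
definition is_tree :: "nat set \<Rightarrow> nat set set \<Rightarrow> bool" where
  "is_tree N TE \<longleftrightarrow> simple_graph N TE \<and> N \<noteq> {} \<and> connected_in TE N
     \<and> card TE = card N - 1"

text \<open>Tree decomposition of (V,E) over tree (N,TE) with bags B.\<close>
definition tree_decomposition ::
  "'a set \<Rightarrow> 'a set set \<Rightarrow> nat set \<Rightarrow> nat set set \<Rightarrow> (nat \<Rightarrow> 'a set) \<Rightarrow> bool" where
  "tree_decomposition V E N TE B \<longleftrightarrow> is_tree N TE
     \<and> (\<Union>i\<in>N. B i) = V
     \<and> (\<forall>e\<in>E. \<exists>i\<in>N. e \<subseteq> B i)
     \<and> (\<forall>v\<in>V. connected_in TE {i\<in>N. v \<in> B i})"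

definition has_treewidth_le :: "'a set \<Rightarrow> 'a set set \<Rightarrow> nat \<Rightarrow> bool" where
  "has_treewidth_le V E k \<longleftrightarrow> (\<exists>N TE B. tree_decomposition V E N TE B
     \<and> (\<forall>i\<in>N. card (B i) \<le> k + 1))"

text \<open>Treewidth: minimum width (max bag size minus one) of a tree decomposition.\<close>
definition treewidth :: "'a set \<Rightarrow> 'a set set \<Rightarrow> nat" where
  "treewidth V E = (LEAST k. has_treewidth_le V E k)"

datatype colour = Red | Blue

definition non_piercing :: "'a set set \<Rightarrow> 'a set \<Rightarrow> 'a set set \<Rightarrow> bool" where
  "non_piercing E V \<H> \<longleftrightarrow> (\<forall>H\<in>\<H>. H \<subseteq> V \<and> connected_in E H)
     \<and> (\<forall>H\<in>\<H>. \<forall>H'\<in>\<H>. connected_in E (H - H'))"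

definition blue_part :: "('a \<Rightarrow> colour) \<Rightarrow> 'a set \<Rightarrow> 'a set" where
  "blue_part c S = {v \<in> S. c v = Blue}"

text \<open>Q = (b(V), EQ) is a primal support for (G, \<H>).\<close>
definition primal_support ::
  "'a set \<Rightarrow> ('a \<Rightarrow> colour) \<Rightarrow> 'a set set \<Rightarrow> 'a set set \<Rightarrow> bool" where
  "primal_support V c \<H> EQ \<longleftrightarrow> simple_graph (blue_part c V) EQ
     \<and> (\<forall>H\<in>\<H>. connected_in EQ (blue_part c H))"

end

theory Submission
  imports Defs
begin

text \<open>
  A tree decomposition of \<open>G\<close> is dismantled leaf by leaf. Let the leaf bag \<open>B\<close> hang at the bag
  \<open>A\<close>, and let \<open>D\<close> be the part cut off by \<open>A\<close>. If \<open>H \<inter> A \<subseteq> K\<close>, then \<open>H - K\<close> avoids \<open>A\<close> and is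
  connected, hence lies on one side of \<open>A\<close>. So fix, for each inclusion-minimal trace \<open>S = H \<inter> A\<close>
  of a member with blue vertices on both sides, one such member \<open>H\<^sub>S\<close> and a blue vertex \<open>u\<^sub>S\<close> of
  \<open>H\<^sub>S\<close> in \<open>D\<close>: every member \<open>K\<close> containing \<open>S\<close> contains \<open>u\<^sub>S\<close> or all of \<open>H\<^sub>S\<close> beyond \<open>A\<close>.
  Replacing \<open>D\<close> by the vertices \<open>u\<^sub>S\<close>, and keeping \<open>u\<^sub>S\<close> in a member only if the member contains
  \<open>S\<close>, preserves the non-piercing property. From a support of the smaller system one reads off a
  vertex \<open>w\<^sub>S\<close> that lies in every member containing \<open>S\<close> but not \<open>u\<^sub>S\<close>, and a new bag consisting of
  the blue vertices of \<open>A \<union> D\<close> and all \<open>w\<^sub>S\<close> is attached. The minimal traces form an antichain in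
  the subsets of \<open>A\<close>, so there are at most \<open>2 ^ t\<close> of them, and the new bag has at most
  \<open>2 * (t + 1) + 3 * 2 ^ t\<close> elements.
\<close>

subsection \<open>Tree decompositions as sets of bags\<close>

text \<open>The tree is left implicit: it is recorded only that a new bag meets the earlier ones inside
  a single one of them.\<close>
inductive tree_bags :: "'a set set \<Rightarrow> bool" where
  single: "tree_bags {A}"
| insert: "\<lbrakk>tree_bags \<B>; A \<in> \<B>; B \<inter> \<Union>\<B> \<subseteq> A\<rbrakk> \<Longrightarrow> tree_bags (insert B \<B>)"

text \<open>Connectedness of \<open>Z\<close> in the graph whose edges join vertices with a common bag.\<close>
definition linked :: "'a set set \<Rightarrow> 'a set \<Rightarrow> bool" where
  "linked \<B> Z \<longleftrightarrow> (\<forall>Y. Y \<subseteq> Z \<and> Y \<noteq> {} \<and> Y \<noteq> Z \<longrightarrow>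
     (\<exists>B\<in>\<B>. B \<inter> Y \<noteq> {} \<and> B \<inter> (Z - Y) \<noteq> {}))"

text \<open>All bags become cliques: this is the largest graph that these bags can decompose, so
  adding edges inside bags costs no width. The support is chosen of this form.\<close>

definition bag_graph :: "'a set set \<Rightarrow> 'a set set" where
  "bag_graph \<B> = {{u, v} | u v B. B \<in> \<B> \<and> u \<in> B \<and> v \<in> B \<and> u \<noteq> v}"

text \<open>A path from a part of \<open>Z\<close> to the rest uses an edge leaving that part, and
  some bag holds both ends of this edge.\<close>

lemma linked_if_connected_in:
  assumes "connected_in E Z" and "\<forall>e\<in>E. \<exists>B\<in>\<B>. e \<subseteq> B"
  shows "linked \<B> Z"
  unfolding linked_def
proof (intro allI impI, elim conjE)
  fix Y assume Y: "Y \<subseteq> Z" "Y \<noteq> {}" "Y \<noteq> Z"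
  then obtain u v where uv: "u \<in> Y" "v \<in> Z" "v \<notin> Y" by blast
  have "(u, v) \<in> (induced_adj E Z)\<^sup>*"
    using assms(1) uv Y unfolding connected_in_def by blast
  then have "v \<notin> Y \<longrightarrow> (\<exists>p q. p \<in> Y \<and> q \<notin> Y \<and> (p, q) \<in> induced_adj E Z)"
    by (induction rule: rtrancl_induct) (use uv in blast)+
  then obtain p q where pq: "p \<in> Y" "q \<notin> Y" "{p, q} \<in> E" "q \<in> Z"
    using uv unfolding induced_adj_def by blast
  then obtain B where "B \<in> \<B>" "{p, q} \<subseteq> B" using assms(2) by blast
  then show "\<exists>B\<in>\<B>. B \<inter> Y \<noteq> {} \<and> B \<inter> (Z - Y) \<noteq> {}" using pq by blast
qed

text \<open>The part of \<open>Z\<close> reachable from \<open>u\<close> is left by no bag, since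
  such a bag would supply one more edge; hence it is all of \<open>Z\<close>.\<close>

lemma connected_in_bag_graph:
  assumes "linked \<B> Z"
  shows "connected_in (bag_graph \<B>) Z"
  unfolding connected_in_def
proof (intro ballI)
  let ?R = "induced_adj (bag_graph \<B>) Z"
  fix u v assume u: "u \<in> Z" and v: "v \<in> Z"
  define Y where "Y = {w \<in> Z. (u, w) \<in> ?R\<^sup>*}"
  have "Y = Z"
  proof (rule ccontr)
    assume "Y \<noteq> Z"
    moreover have "Y \<subseteq> Z" "Y \<noteq> {}" using u unfolding Y_def by auto
    ultimately obtain B where "B \<in> \<B>" "B \<inter> Y \<noteq> {}" "B \<inter> (Z - Y) \<noteq> {}"
      using assms unfolding linked_def by blast
    then obtain p q where pq: "B \<in> \<B>" "p \<in> B" "p \<in> Y" "q \<in> B" "q \<in> Z" "q \<notin> Y" by blast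
    then have "(p, q) \<in> ?R"
      unfolding induced_adj_def bag_graph_def Y_def by blast
    then have "q \<in> Y" using pq unfolding Y_def by (auto intro: rtrancl_into_rtrancl)
    then show False using pq by blast
  qed
  then show "(u, v) \<in> ?R\<^sup>*" using v unfolding Y_def by blast
qed

section \<open>From trees to sets of bags and back\<close>

text \<open>The degrees sum to \<open>2 * (card N - 1)\<close>, so some vertex has degree below 2;
  connectedness and a second vertex rule out degree 0.\<close>

lemma tree_leaf_exists:
  assumes tree: "is_tree N TE" and card: "2 \<le> card N"
  obtains x y where "x \<in> N" "y \<in> N" "x \<noteq> y" "{e \<in> TE. x \<in> e} = {{x, y}}"
proof -
  have fin: "finite N" and edges: "\<And>e. e \<in> TE \<Longrightarrow> \<exists>u v. e = {u, v} \<and> u \<noteq> v \<and> u \<in> N \<and> v \<in> N"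
    and conn: "connected_in TE N" and cTE: "card TE = card N - 1"
    using tree unfolding is_tree_def simple_graph_def by auto
  have finTE: "finite TE"
    by (rule finite_subset[of _ "Pow N"]) (use fin edges in auto)
  have "(\<Sum>v\<in>N. card {e \<in> TE. v \<in> e}) = 2 * card TE"
  proof (rule sum_multicount[OF fin finTE], intro ballI)
    fix e assume "e \<in> TE"
    then obtain u v where "e = {u, v}" "u \<noteq> v" "u \<in> N" "v \<in> N" using edges by blast
    moreover from this have "{i \<in> N. i \<in> e} = {u, v}" by auto
    ultimately show "card {i \<in> N. i \<in> e} = 2" by simp
  qed
  moreover have "(\<Sum>v\<in>N. 2) \<le> (\<Sum>v\<in>N. card {e \<in> TE. v \<in> e})"
    if "\<forall>v\<in>N. 2 \<le> card {e \<in> TE. v \<in> e}"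
    by (rule sum_mono) (use that in auto)
  ultimately obtain x where x: "x \<in> N" and deg: "card {e \<in> TE. x \<in> e} < 2"
    using cTE card by fastforce
  obtain z where z: "z \<in> N" "z \<noteq> x"
  proof -
    have "N \<noteq> {x}" using card by auto
    then show thesis using x that by blast
  qed
  have "(x, z) \<in> (induced_adj TE N)\<^sup>*" using conn x z unfolding connected_in_def by blast
  then obtain y where "(x, y) \<in> induced_adj TE N"
    using z by (metis converse_rtranclE)
  then have y: "{x, y} \<in> TE" "y \<in> N" unfolding induced_adj_def by auto
  have "x \<noteq> y" using edges[OF y(1)] by (auto simp: doubleton_eq_iff)
  moreover have "{e \<in> TE. x \<in> e} = {{x, y}}"
  proof -
    have "card {e \<in> TE. x \<in> e} \<le> card {{x, y}}" using deg by simp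
    moreover have "{{x, y}} \<subseteq> {e \<in> TE. x \<in> e}" using y by auto
    moreover have "finite {e \<in> TE. x \<in> e}" using finTE by simp
    ultimately show ?thesis using card_seteq[of "{e \<in> TE. x \<in> e}" "{{x, y}}"] by metis
  qed
  ultimately show thesis using that x y by blast
qed

text \<open>Folding the leaf onto its neighbour maps paths of the old tree to paths of the new one.\<close>
lemma connected_in_delete_leaf:
  assumes conn: "connected_in TE S" and leaf: "{e \<in> TE. x \<in> e} = {{x, y}}"
  shows "connected_in (TE - {{x, y}}) (S - {x})"
  unfolding connected_in_def
proof (intro ballI)
  define h where "h z = (if z = x then y else z)" for z
  let ?R = "induced_adj (TE - {{x, y}}) (S - {x})"
  fix u v assume uv: "u \<in> S - {x}" "v \<in> S - {x}"
  have step: "(h p, h q) \<in> ?R\<^sup>*" if "(p, q) \<in> induced_adj TE S" for p q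
  proof -
    have pq: "{p, q} \<in> TE" "p \<in> S" "q \<in> S" using that unfolding induced_adj_def by auto
    show ?thesis
    proof (cases "x \<in> {p, q}")
      case True
      then have "{p, q} \<in> {e \<in> TE. x \<in> e}" using pq by simp
      then have "{p, q} = {x, y}" unfolding leaf by simp
      then have "h p = h q" unfolding h_def by (auto simp: doubleton_eq_iff)
      then show ?thesis by simp
    next
      case False
      then have "(p, q) \<in> ?R" using pq unfolding induced_adj_def by (auto simp: doubleton_eq_iff)
      then show ?thesis using False unfolding h_def by auto
    qed
  qed
  have "(u, v) \<in> (induced_adj TE S)\<^sup>*" using conn uv unfolding connected_in_def by blast
  then have "(h u, h v) \<in> ?R\<^sup>*"
    by (induction rule: rtrancl_induct) (use step in \<open>auto intro: rtrancl_trans\<close>)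
  then show "(u, v) \<in> ?R\<^sup>*" using uv unfolding h_def by auto
qed

text \<open>Induction on the number of nodes, removing a leaf. A vertex common to the leaf bag and
  another bag lies in the bag of the leaf's neighbour, because the nodes holding it are
  connected.\<close>

lemma tree_bags_if_tree:
  assumes "is_tree N TE" and "\<And>v. connected_in TE {i \<in> N. v \<in> B i}"
  shows "tree_bags (B ` N)"
  using assms
proof (induction "card N" arbitrary: N TE rule: less_induct)
  case less
  have fin: "finite N" and ne: "N \<noteq> {}"
    using less.prems unfolding is_tree_def simple_graph_def by auto
  show ?case
  proof (cases "2 \<le> card N")
    case False
    then have "card N = 1" using card_gt_0_iff[of N] fin ne by linarith
    then obtain i where "N = {i}" using card_1_singletonE by blast
    then show ?thesis by (simp add: tree_bags.single)
  next
    case True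
    obtain x y where xy: "x \<in> N" "y \<in> N" "x \<noteq> y" and leaf: "{e \<in> TE. x \<in> e} = {{x, y}}"
      using tree_leaf_exists[OF less.prems(1) True] by blast
    let ?N = "N - {x}" and ?T = "TE - {{x, y}}"
    have e: "{x, y} \<in> TE" using leaf by blast
    have "simple_graph ?N ?T"
      unfolding simple_graph_def
    proof (intro conjI ballI)
      fix e assume e: "e \<in> ?T"
      then obtain u v where uv: "e = {u, v}" "u \<noteq> v" "u \<in> N" "v \<in> N"
        using less.prems(1) unfolding is_tree_def simple_graph_def by blast
      moreover have "x \<notin> e" using e leaf by blast
      ultimately show "\<exists>u v. e = {u, v} \<and> u \<noteq> v \<and> u \<in> ?N \<and> v \<in> ?N" by blast
    qed (use fin in simp)
    moreover have "connected_in ?T ?N"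
      using connected_in_delete_leaf[OF _ leaf] less.prems(1) unfolding is_tree_def by blast
    moreover have "card ?T = card ?N - 1"
    proof -
      have "card TE = card N - 1" using less.prems(1) unfolding is_tree_def by blast
      moreover have "card ?T = card TE - 1" using e by (simp add: card_Diff_singleton)
      ultimately show ?thesis using xy by (simp add: card_Diff_singleton)
    qed
    ultimately have tree: "is_tree ?N ?T" unfolding is_tree_def using xy by blast
    have "connected_in ?T {i \<in> ?N. v \<in> B i}" for v
    proof -
      have "{i \<in> ?N. v \<in> B i} = {i \<in> N. v \<in> B i} - {x}" by blast
      then show ?thesis using connected_in_delete_leaf[OF less.prems(2) leaf] by metis
    qed
    then have IH: "tree_bags (B ` ?N)"
      using less.hyps[OF _ tree] card_Diff1_less[OF fin xy(1)] by blast
    have "B x \<inter> \<Union>(B ` ?N) \<subseteq> B y"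
    proof
      fix v assume "v \<in> B x \<inter> \<Union>(B ` ?N)"
      then obtain i where i: "i \<in> N" "i \<noteq> x" "v \<in> B i" "v \<in> B x" by blast
      then have "(x, i) \<in> (induced_adj TE {i \<in> N. v \<in> B i})\<^sup>*"
        using less.prems(2)[of v] xy unfolding connected_in_def by blast
      then obtain z where "(x, z) \<in> induced_adj TE {i \<in> N. v \<in> B i}"
        using i by (metis converse_rtranclE)
      then have z: "{x, z} \<in> TE" "v \<in> B z" unfolding induced_adj_def by auto
      then have "{x, z} \<in> {e \<in> TE. x \<in> e}" by simp
      then have "{x, z} = {x, y}" unfolding leaf by simp
      then show "v \<in> B y" using z by (auto simp: doubleton_eq_iff)
    qed
    then have "tree_bags (insert (B x) (B ` ?N))"
      using tree_bags.insert[OF IH, of "B y"] xy by blast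
    moreover have "insert (B x) (B ` ?N) = B ` N" using xy by blast
    ultimately show ?thesis by simp
  qed
qed

lemma induced_adj_mono: "E \<subseteq> E' \<Longrightarrow> S \<subseteq> S' \<Longrightarrow> induced_adj E S \<subseteq> induced_adj E' S'"
  unfolding induced_adj_def by blast

lemma connected_in_mono: "connected_in E S \<Longrightarrow> E \<subseteq> E' \<Longrightarrow> connected_in E' S"
  unfolding connected_in_def using rtrancl_mono[OF induced_adj_mono] by blast

lemma connected_in_insert_leaf:
  assumes conn: "connected_in E S" and y: "y \<in> S"
  shows "connected_in (insert {x, y} E) (insert x S)"
proof -
  let ?R = "induced_adj (insert {x, y} E) (insert x S)"
  have xy: "(x, y) \<in> ?R" "(y, x) \<in> ?R" using y unfolding induced_adj_def by (auto simp: insert_commute)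
  have S: "(u, v) \<in> ?R\<^sup>*" if "u \<in> S" "v \<in> S" for u v
    using conn that rtrancl_mono[OF induced_adj_mono, of E "insert {x, y} E" S "insert x S"]
    unfolding connected_in_def by blast
  have "(u, y) \<in> ?R\<^sup>*" "(y, u) \<in> ?R\<^sup>*" if "u \<in> insert x S" for u
    using that S[OF _ y] S[OF y] xy by auto
  then show ?thesis unfolding connected_in_def by (meson rtrancl_trans)
qed

text \<open>Each inserted bag becomes a fresh leaf next to a node carrying \<open>A\<close>. A
  vertex of the new bag either lies in \<open>A\<close>, so the nodes holding it gain a leaf, or
  lies in no earlier bag.\<close>

lemma tree_if_tree_bags:
  assumes "tree_bags \<B>"
  shows "\<exists>N TE B. is_tree N TE \<and> B ` N = \<B> \<and> (\<forall>v. connected_in TE {i \<in> N. v \<in> B i})"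
  using assms
proof induction
  case (single A)
  have "is_tree {0} {}" "(\<lambda>_. A) ` {0::nat} = {A}"
    "\<forall>v. connected_in {} {i \<in> {0::nat}. v \<in> A}"
    unfolding is_tree_def simple_graph_def connected_in_def by auto
  then show ?case by blast
next
  case (insert \<B> A C)
  then obtain N TE B where T: "is_tree N TE" and B: "B ` N = \<B>"
    and conn: "\<And>v. connected_in TE {i \<in> N. v \<in> B i}" by blast
  have fin: "finite N" using T unfolding is_tree_def simple_graph_def by blast
  obtain x where x: "x \<notin> N" using fin ex_new_if_finite infinite_UNIV_nat by blast
  obtain y where y: "y \<in> N" "B y = A" using \<open>A \<in> \<B>\<close> unfolding B[symmetric] by blast
  have xy: "x \<noteq> y" using x y by blast
  let ?N = "insert x N" and ?T = "insert {x, y} TE" and ?B = "B(x := C)"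
  have edges: "\<And>e. e \<in> TE \<Longrightarrow> \<exists>u v. e = {u, v} \<and> u \<noteq> v \<and> u \<in> N \<and> v \<in> N"
    using T unfolding is_tree_def simple_graph_def by blast
  have new: "{x, y} \<notin> TE" using edges x by (metis doubleton_eq_iff)
  have finTE: "finite TE"
    by (rule finite_subset[of _ "Pow N"]) (use fin edges in auto)
  have "simple_graph ?N ?T"
    unfolding simple_graph_def
  proof (intro conjI ballI)
    fix e assume "e \<in> ?T"
    then consider "e = {x, y}" | "e \<in> TE" by blast
    then show "\<exists>u v. e = {u, v} \<and> u \<noteq> v \<and> u \<in> ?N \<and> v \<in> ?N"
      by cases (use xy y edges in blast)+
  qed (use fin in simp)
  moreover have "connected_in ?T ?N"
    using connected_in_insert_leaf[of TE N y x] T y(1) unfolding is_tree_def by simp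
  moreover have "card ?T = card ?N - 1"
  proof -
    have "card N > 0" using y fin card_gt_0_iff by blast
    then show ?thesis using T new finTE x fin unfolding is_tree_def by simp
  qed
  ultimately have "is_tree ?N ?T" unfolding is_tree_def by blast
  moreover have "?B ` ?N = insert C \<B>" using B x by auto
  moreover have "connected_in ?T {i \<in> ?N. v \<in> ?B i}" for v
  proof (cases "v \<in> C")
    case False
    then have "{i \<in> ?N. v \<in> ?B i} = {i \<in> N. v \<in> B i}" using x by auto
    then show ?thesis using connected_in_mono[OF conn] by (metis subset_insertI)
  next
    case v: True
    show ?thesis
    proof (cases "v \<in> A")
      case True
      have "{i \<in> ?N. v \<in> ?B i} = insert x {i \<in> N. v \<in> B i}" using x v by auto
      then show ?thesis using connected_in_insert_leaf[OF conn[of v], of y x] True y by simp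
    next
      case False
      then have "v \<notin> \<Union>\<B>" using v \<open>C \<inter> \<Union>\<B> \<subseteq> A\<close> by blast
      then have "{i \<in> ?N. v \<in> ?B i} = {x}" using x v B by auto
      then show ?thesis unfolding connected_in_def by simp
    qed
  qed
  ultimately show ?case by blast
qed

subsection \<open>Cutting off a leaf bag\<close>

text \<open>Removing a fixed element \<open>a\<close> is injective on an antichain, since two sets
  that differ at most in \<open>a\<close> are comparable. This is weaker than Sperner's bound but
  enough for the width.\<close>

lemma card_antichain_le:
  assumes fin: "finite A" and card: "card A \<le> Suc t" and sub: "M \<subseteq> Pow A"
    and anti: "\<And>S S'. S \<in> M \<Longrightarrow> S' \<in> M \<Longrightarrow> S \<subseteq> S' \<Longrightarrow> S = S'"
  shows "card M \<le> 2 ^ t"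
proof (cases "A = {}")
  case True
  then have "card M \<le> card {{} :: 'a set}" using sub by (intro card_mono) auto
  also have "\<dots> \<le> 2 ^ t" by simp
  finally show ?thesis .
next
  case False
  then obtain a where a: "a \<in> A" by blast
  have "inj_on (\<lambda>S. S - {a}) M"
  proof (rule inj_onI)
    fix S S' assume S: "S \<in> M" "S' \<in> M" "S - {a} = S' - {a}"
    then have "S \<subseteq> S' \<or> S' \<subseteq> S" by blast
    then show "S = S'" using anti S by blast
  qed
  then have "card M \<le> card (Pow (A - {a}))"
    by (rule card_inj_on_le) (use sub fin in auto)
  also have "\<dots> = 2 ^ (card A - 1)" using fin a by (simp add: card_Pow card_Diff_singleton)
  also have "\<dots> \<le> 2 ^ t" using card by (intro power_increasing) auto
  finally show ?thesis .
qed

text \<open>\<open>b\<close> is the set of blue vertices and \<open>X B\<close> consists of the blue vertices that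
  represent, at the bag \<open>B\<close>, the parts of the graph already cut off there. Having the empty set
  in the family makes the connectedness of a member \<open>H = H - {}\<close> a special case of the
  condition on differences.\<close>
definition bag_system ::
  "'a set \<Rightarrow> nat \<Rightarrow> 'a set set \<Rightarrow> ('a set \<Rightarrow> 'a set) \<Rightarrow> 'a set set \<Rightarrow> bool" where
  "bag_system b t \<B> X \<H> \<longleftrightarrow>
     (\<forall>B\<in>\<B>. finite B \<and> card B \<le> Suc t) \<and>
     (\<forall>B\<in>\<B>. finite (X B) \<and> card (X B) \<le> 2 ^ t \<and> X B \<subseteq> b \<and> X B \<inter> \<Union>\<B> = {}) \<and>
     (\<forall>B\<in>\<B>. \<forall>B'\<in>\<B>. B \<noteq> B' \<longrightarrow> X B \<inter> X B' = {}) \<and>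
     {} \<in> \<H> \<and>
     (\<forall>H\<in>\<H>. H \<subseteq> (\<Union>B\<in>\<B>. B \<union> X B)) \<and>
     (\<forall>H\<in>\<H>. \<forall>K\<in>\<H>. linked ((\<lambda>B. B \<union> X B) ` \<B>) (H - K))"

lemma bag_systemD:
  assumes "bag_system b t \<B> X \<H>"
  shows "C \<in> \<B> \<Longrightarrow> finite C" "C \<in> \<B> \<Longrightarrow> card C \<le> Suc t"
    and "C \<in> \<B> \<Longrightarrow> finite (X C)" "C \<in> \<B> \<Longrightarrow> card (X C) \<le> 2 ^ t"
    and "C \<in> \<B> \<Longrightarrow> X C \<subseteq> b" "C \<in> \<B> \<Longrightarrow> X C \<inter> \<Union>\<B> = {}"
    and "C \<in> \<B> \<Longrightarrow> C' \<in> \<B> \<Longrightarrow> C \<noteq> C' \<Longrightarrow> X C \<inter> X C' = {}"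
    and "{} \<in> \<H>" "H \<in> \<H> \<Longrightarrow> H \<subseteq> (\<Union>C\<in>\<B>. C \<union> X C)"
    and "H \<in> \<H> \<Longrightarrow> K \<in> \<H> \<Longrightarrow> linked ((\<lambda>C. C \<union> X C) ` \<B>) (H - K)"
  using assms unfolding bag_system_def by simp_all

text \<open>The last clause is what makes the induction work: it supplies, in the bag \<open>f B\<close>, the
  vertex that connects the sets missing the representative \<open>u\<close> across the separator.\<close>
definition support_bags ::
  "'a set \<Rightarrow> nat \<Rightarrow> 'a set set \<Rightarrow> ('a set \<Rightarrow> 'a set) \<Rightarrow> 'a set set \<Rightarrow>
   'a set set \<Rightarrow> ('a set \<Rightarrow> 'a set) \<Rightarrow> bool" where
  "support_bags b t \<B> X \<H> \<C> f \<longleftrightarrow>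
     tree_bags \<C> \<and>
     (\<forall>C\<in>\<C>. finite C \<and> card C \<le> 2 ^ (t + 2) + t + 1) \<and>
     \<Union>\<C> = b \<inter> (\<Union>B\<in>\<B>. B \<union> X B) \<and>
     (\<forall>B\<in>\<B>. f B \<in> \<C> \<and> b \<inter> B \<subseteq> f B \<and> X B \<subseteq> f B) \<and>
     (\<forall>H\<in>\<H>. linked \<C> (b \<inter> H)) \<and>
     (\<forall>B\<in>\<B>. \<forall>u\<in>X B. \<forall>H\<in>\<H>. u \<in> H \<and> b \<inter> H \<noteq> {u} \<longrightarrow>
        (\<exists>w\<in>f B. w \<noteq> u \<and> (\<forall>K\<in>\<H>. H - {u} \<subseteq> K \<and> u \<notin> K \<longrightarrow> w \<in> K)))"

lemma support_bags_link:
  assumes "support_bags b t \<B> X \<H> \<C> f" "B \<in> \<B>" "u \<in> X B" "H \<in> \<H>" "u \<in> H" "b \<inter> H \<noteq> {u}"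
  obtains w where "w \<in> f B" "w \<noteq> u" "\<And>K. K \<in> \<H> \<Longrightarrow> H - {u} \<subseteq> K \<Longrightarrow> u \<notin> K \<Longrightarrow> w \<in> K"
proof -
  have "\<forall>B\<in>\<B>. \<forall>u\<in>X B. \<forall>H\<in>\<H>. u \<in> H \<and> b \<inter> H \<noteq> {u} \<longrightarrow>
      (\<exists>w\<in>f B. w \<noteq> u \<and> (\<forall>K\<in>\<H>. H - {u} \<subseteq> K \<and> u \<notin> K \<longrightarrow> w \<in> K))"
    using assms(1) unfolding support_bags_def by (elim conjE)
  from this[rule_format, OF assms(2-4) conjI[OF assms(5,6)]] show thesis using that by auto
qed

lemma linkedI:
  assumes "\<And>Y. \<lbrakk>Y \<subseteq> Z; Y \<noteq> {}; Y \<noteq> Z; \<And>B. B \<in> \<B> \<Longrightarrow> B \<inter> Y = {} \<or> B \<inter> (Z - Y) = {}\<rbrakk> \<Longrightarrow> False"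
  shows "linked \<B> Z"
  using assms unfolding linked_def by meson

lemma linkedD:
  assumes "linked \<B> Z" "Y \<subseteq> Z" "Y \<noteq> {}" "\<And>B. B \<in> \<B> \<Longrightarrow> B \<inter> Y \<noteq> {} \<Longrightarrow> B \<inter> (Z - Y) = {}"
  shows "Y = Z"
  using assms unfolding linked_def by blast

section \<open>The reduced system at a leaf bag\<close>

locale leaf_bag =
  fixes b :: "'a set" and t :: nat and \<B> :: "'a set set" and X :: "'a set \<Rightarrow> 'a set"
    and \<H> :: "'a set set" and A B :: "'a set"
  assumes A: "A \<in> \<B>" and B: "B \<notin> \<B>" and leaf: "B \<inter> \<Union>\<B> \<subseteq> A"
    and sys: "bag_system b t (insert B \<B>) X \<H>"
begin

text \<open>The earlier representatives at \<open>A\<close> count as cut off too and get replaced;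
  otherwise they would accumulate when several leaves hang at \<open>A\<close>.\<close>

definition D :: "'a set" where "D = (B - A) \<union> X A \<union> X B"

definition traces :: "'a set set" where
  "traces = {H \<inter> A | H. H \<in> \<H> \<and> H \<inter> D \<inter> b \<noteq> {} \<and> H \<inter> b - (A \<union> D) \<noteq> {}}"

definition M :: "'a set set" where
  "M = {S \<in> traces. \<forall>S'\<in>traces. S' \<subseteq> S \<longrightarrow> S' = S}"

definition member :: "'a set \<Rightarrow> 'a set" where
  "member S = (SOME H. H \<in> \<H> \<and> H \<inter> A = S \<and> H \<inter> D \<inter> b \<noteq> {} \<and> H \<inter> b - (A \<union> D) \<noteq> {})"

definition rep :: "'a set \<Rightarrow> 'a" where
  "rep S = (SOME u. u \<in> member S \<inter> D \<inter> b)"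

definition reduce :: "'a set \<Rightarrow> 'a set" where
  "reduce H = (H - D) \<union> {rep S | S. S \<in> M \<and> S \<subseteq> H \<and> rep S \<in> H}"

definition X' :: "'a set \<Rightarrow> 'a set" where "X' = X(A := rep ` M)"

lemma finite_A: "finite A" "finite B" "card A \<le> Suc t" "card B \<le> Suc t"
  using bag_systemD(1,2)[OF sys] A by simp_all

lemmas X_props = bag_systemD(3-6)[OF sys]
lemmas X_disjoint = bag_systemD(7)[OF sys]
lemmas empty_mem = bag_systemD(8)[OF sys]
lemmas subset_bags = bag_systemD(9)[OF sys]
lemmas linked_diff = bag_systemD(10)[OF sys]

lemma D_disjoint: "D \<inter> \<Union>\<B> = {}"
  using leaf X_props(4)[of A] X_props(4)[of B] A unfolding D_def by blast

lemma D_disjoint_X: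
  assumes "C \<in> \<B>" "C \<noteq> A"
  shows "D \<inter> X C = {}"
proof -
  have "C \<noteq> B" using assms B by blast
  then have "X C \<inter> X B = {}" "X C \<inter> X A = {}" using X_disjoint assms A by blast+
  moreover have "X C \<inter> B = {}" using X_props(4)[of C] assms by blast
  ultimately show ?thesis unfolding D_def by blast
qed

lemma A_D: "A \<inter> D = {}"
  using D_disjoint A by blast

text \<open>\<open>A\<close> still separates \<open>D\<close> from the rest once the bags are
  enlarged by their representatives.\<close>

lemma bag_sides:
  assumes "C \<in> insert B \<B>"
  shows "(C = A \<or> C = B) \<and> C \<union> X C \<subseteq> A \<union> D \<or> C \<in> \<B> \<and> C \<noteq> A \<and> (C \<union> X C) \<inter> D = {}"
proof (cases "C = A \<or> C = B")
  case True
  then show ?thesis unfolding D_def by blast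
next
  case False
  then have C: "C \<in> \<B>" "C \<noteq> A" using assms by blast+
  then show ?thesis using D_disjoint D_disjoint_X by blast
qed

text \<open>\<open>H - K\<close> avoids \<open>A\<close>, so an enlarged bag meeting it inside
  \<open>D\<close> cannot meet it outside \<open>D\<close>; being linked, \<open>H - K\<close> lies
  on one side.\<close>

lemma diff_one_side:
  assumes "H \<in> \<H>" "K \<in> \<H>" "H \<inter> A \<subseteq> K"
  shows "H \<inter> D \<subseteq> K \<or> H - D \<subseteq> K"
proof (rule ccontr)
  assume neg: "\<not> ?thesis"
  have "(H - K) \<inter> D = H - K"
  proof (rule linkedD[OF linked_diff[OF assms(1,2)]])
    fix C assume "C \<in> (\<lambda>B. B \<union> X B) ` insert B \<B>" and ne: "C \<inter> ((H - K) \<inter> D) \<noteq> {}"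
    then obtain C0 where C0: "C0 \<in> insert B \<B>" "C = C0 \<union> X C0" by blast
    then have "C \<subseteq> A \<union> D" using bag_sides[OF C0(1)] ne by blast
    then show "C \<inter> ((H - K) - (H - K) \<inter> D) = {}" using assms(3) by blast
  qed (use neg in auto)
  then show False using neg by blast
qed

lemma member_props:
  assumes "S \<in> M"
  shows "member S \<in> \<H>" "member S \<inter> A = S" "member S \<inter> b - (A \<union> D) \<noteq> {}"
    and "rep S \<in> member S" "rep S \<in> D" "rep S \<in> b"
proof -
  have "\<exists>H. H \<in> \<H> \<and> H \<inter> A = S \<and> H \<inter> D \<inter> b \<noteq> {} \<and> H \<inter> b - (A \<union> D) \<noteq> {}"
    using assms unfolding M_def traces_def by blast
  note ex = someI_ex[OF this, folded member_def]
  then show "member S \<in> \<H>" "member S \<inter> A = S" "member S \<inter> b - (A \<union> D) \<noteq> {}" by auto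
  have ne: "member S \<inter> D \<inter> b \<noteq> {}" using ex by blast
  have "rep S \<in> member S \<inter> D \<inter> b"
    unfolding rep_def by (rule someI_ex) (use ne in blast)
  then show "rep S \<in> member S" "rep S \<in> D" "rep S \<in> b" by auto
qed

lemma M_subset_Pow: "M \<subseteq> Pow A"
  unfolding M_def traces_def by blast

lemma M_antichain: "S \<in> M \<Longrightarrow> S' \<in> M \<Longrightarrow> S \<subseteq> S' \<Longrightarrow> S = S'"
  unfolding M_def by blast

lemma card_M: "card M \<le> 2 ^ t" and finite_M: "finite M"
  using card_antichain_le[OF finite_A(1,3) M_subset_Pow M_antichain]
    finite_subset[OF M_subset_Pow] finite_A(1) by auto

lemma crossing_trace:
  assumes "H \<in> \<H>" "H \<inter> D \<inter> b \<noteq> {}" "H \<inter> b - (A \<union> D) \<noteq> {}"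
  obtains S where "S \<in> M" "S \<subseteq> H"
proof -
  have "finite traces"
    by (rule finite_subset[of _ "Pow A"]) (use finite_A in \<open>auto simp: traces_def\<close>)
  moreover have "H \<inter> A \<in> traces" using assms unfolding traces_def by blast
  ultimately obtain S where "S \<in> traces" "S \<subseteq> H \<inter> A" "\<forall>S'\<in>traces. S' \<subseteq> S \<longrightarrow> S = S'"
    using finite_has_minimal2 by metis
  then have "S \<in> M" "S \<subseteq> H" unfolding M_def by auto
  then show thesis using that by blast
qed

lemma reduce_subset: "reduce H \<subseteq> H"
  unfolding reduce_def by blast

lemma reduce_outside: "reduce H - D = H - D"
  unfolding reduce_def using member_props(5) by blast

lemma rep_mem_reduce: "S \<in> M \<Longrightarrow> S \<subseteq> H \<Longrightarrow> rep S \<in> H \<Longrightarrow> rep S \<in> reduce H"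
  unfolding reduce_def by blast

lemma reduce_D: "reduce H \<inter> D \<subseteq> rep ` M"
  unfolding reduce_def by blast

text \<open>Minimality of \<open>S\<close> leaves no other representative in the reduction of its member.\<close>
lemma reduce_member_D:
  assumes "S \<in> M"
  shows "reduce (member S) \<inter> D = {rep S}"
proof -
  have "S' = S" if "S' \<in> M" "S' \<subseteq> member S" for S'
    using that M_antichain[of S' S] M_subset_Pow member_props(2)[OF assms] assms by blast
  moreover have "S \<subseteq> member S" using member_props(2)[OF assms] by blast
  ultimately show ?thesis
    using assms member_props(4,5)[OF assms] unfolding reduce_def by blast
qed

text \<open>A bad splitting of the reduced difference has one side \<open>Y\<close> away from
  \<open>A\<close> and \<open>D\<close>. That side is closed under the old bags in
  \<open>H - K\<close> and so equals it; then \<open>K\<close> contains all of \<open>H\<close> in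
  \<open>A \<union> D\<close>, and its reduction keeps every representative that the reduction of
  \<open>H\<close> keeps.\<close>

lemma linked_reduce:
  assumes H: "H \<in> \<H>" and K: "K \<in> \<H>"
  shows "linked ((\<lambda>B. B \<union> X' B) ` \<B>) (reduce H - reduce K)"
proof (rule linkedI)
  let ?Z = "reduce H - reduce K"
  fix Y0 assume Y0: "Y0 \<subseteq> ?Z" "Y0 \<noteq> {}" "Y0 \<noteq> ?Z"
    and split0: "\<And>C. C \<in> (\<lambda>B. B \<union> X' B) ` \<B> \<Longrightarrow> C \<inter> Y0 = {} \<or> C \<inter> (?Z - Y0) = {}"
  have split0': "(C \<union> X' C) \<inter> Y0 = {} \<or> (C \<union> X' C) \<inter> (?Z - Y0) = {}" if "C \<in> \<B>" for C
    by (rule split0) (rule imageI[OF that])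
  have XA: "X' A = rep ` M" unfolding X'_def by simp
  obtain Y where Y: "Y \<subseteq> ?Z" "Y \<noteq> {}" "Y \<noteq> ?Z" and YA: "Y \<inter> (A \<union> rep ` M) = {}"
    and split: "\<And>C. C \<in> \<B> \<Longrightarrow> (C \<union> X' C) \<inter> Y = {} \<or> (C \<union> X' C) \<inter> (?Z - Y) = {}"
  proof (cases "Y0 \<inter> (A \<union> rep ` M) = {}")
    case True
    then show thesis by (rule that[OF Y0 _ split0'])
  next
    case False
    then have disj: "(?Z - Y0) \<inter> (A \<union> rep ` M) = {}" using split0'[OF A] unfolding XA by blast
    have eq: "?Z - (?Z - Y0) = Y0" using Y0(1) by blast
    show thesis
    proof (rule that[of "?Z - Y0", OF _ _ _ disj])
      show "?Z - Y0 \<noteq> {}" "?Z - Y0 \<noteq> ?Z" using Y0 by blast+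
      show "(C \<union> X' C) \<inter> (?Z - Y0) = {} \<or> (C \<union> X' C) \<inter> (?Z - (?Z - Y0)) = {}"
        if "C \<in> \<B>" for C
        using split0'[OF that] unfolding eq by blast
    qed blast
  qed
  have YR: "Y \<inter> (A \<union> D) = {}" using Y(1) YA reduce_D[of H] by blast
  have YHK: "Y \<subseteq> H - K" using Y(1) YR reduce_subset[of H] reduce_outside[of K] by blast
  have "Y = H - K"
  proof (rule linkedD[OF linked_diff[OF H K] YHK Y(2)])
    fix C assume "C \<in> (\<lambda>B. B \<union> X B) ` insert B \<B>" and ne: "C \<inter> Y \<noteq> {}"
    then obtain C0 where C0: "C0 \<in> insert B \<B>" "C = C0 \<union> X C0" by blast
    then have C: "C0 \<in> \<B>" "C0 \<noteq> A" "C \<inter> D = {}" using bag_sides[OF C0(1)] ne YR by blast+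
    then have "C = C0 \<union> X' C0" using C0 unfolding X'_def by simp
    then have "C \<inter> (?Z - Y) = {}" using split[OF C(1)] ne by simp
    then show "C \<inter> (H - K - Y) = {}"
      using C(3) reduce_outside[of H] reduce_subset[of K] by blast
  qed
  then have sub: "H \<inter> A \<subseteq> K" "H \<inter> D \<subseteq> K" using YR by blast+
  obtain v where v: "v \<in> ?Z" "v \<notin> Y" using Y by blast
  \<comment> \<open>Outside \<open>D\<close> the reduced difference agrees with
    \<open>H - K\<close>, which is \<open>Y\<close>.\<close>
  have "v \<in> D"
    using v \<open>Y = H - K\<close> reduce_subset[of H] reduce_outside[of K] by blast
  then obtain S where S: "S \<in> M" "S \<subseteq> H" "v = rep S" "v \<in> H"
    using v unfolding reduce_def by blast
  then have "v \<in> reduce K"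
    using rep_mem_reduce[of S K] sub M_subset_Pow \<open>v \<in> D\<close> by blast
  then show False using v by blast
qed

lemma bag_system_reduce: "bag_system b t \<B> X' (reduce ` \<H>)"
  unfolding bag_system_def
proof (intro conjI ballI impI)
  have rD: "rep ` M \<subseteq> D" "rep ` M \<subseteq> b" using member_props by blast+
  have card_rep: "finite (rep ` M)" "card (rep ` M) \<le> 2 ^ t"
    using finite_M card_M card_image_le[OF finite_M, of rep] by auto
  fix C assume C: "C \<in> \<B>"
  show "finite C" "card C \<le> Suc t" using bag_systemD(1,2)[OF sys] C by simp_all
  show "finite (X' C)" "card (X' C) \<le> 2 ^ t" "X' C \<subseteq> b"
    using X_props[of C] C card_rep rD unfolding X'_def by auto
  show "X' C \<inter> \<Union>\<B> = {}"
  proof (cases "C = A")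
    case True
    then have "X' C \<subseteq> D" using rD unfolding X'_def by simp
    then show ?thesis using D_disjoint by blast
  next
    case False
    then have "X' C = X C" unfolding X'_def by simp
    then show ?thesis using X_props(4)[of C] C by simp blast
  qed
  fix C' assume C': "C' \<in> \<B>" "C \<noteq> C'"
  have rX: "rep ` M \<inter> X C'' = {}" if "C'' \<in> \<B>" "C'' \<noteq> A" for C''
    using D_disjoint_X[OF that] rD by blast
  show "X' C \<inter> X' C' = {}"
  proof (cases "C = A \<or> C' = A")
    case True
    then show ?thesis using rX[of C] rX[of C'] C C' unfolding X'_def by (auto simp: Int_commute)
  next
    case False
    then show ?thesis using X_disjoint[of C C'] C C' unfolding X'_def by simp
  qed
next
  have "reduce {} = {}" using reduce_subset by blast
  then show "{} \<in> reduce ` \<H>" using empty_mem by force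
next
  fix H' assume "H' \<in> reduce ` \<H>"
  then obtain H where H: "H \<in> \<H>" "H' = reduce H" by blast
  show "H' \<subseteq> (\<Union>C\<in>\<B>. C \<union> X' C)"
  proof
    fix v assume v: "v \<in> H'"
    show "v \<in> (\<Union>C\<in>\<B>. C \<union> X' C)"
    proof (cases "v \<in> D")
      case True
      then have "v \<in> X' A" using v H reduce_D unfolding X'_def by auto
      then show ?thesis using A by blast
    next
      case False
      obtain C where C: "C \<in> insert B \<B>" "v \<in> C \<union> X C"
        using subset_bags[OF H(1)] reduce_subset v H by blast
      show ?thesis
      proof (cases "v \<in> A")
        case True
        then show ?thesis using A by blast
      next
        case nA: False
        then have "C \<in> \<B>" "C \<noteq> A" using bag_sides[OF C(1)] C(2) False by blast+
        then show ?thesis using C(2) unfolding X'_def by auto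
      qed
    qed
  qed
next
  fix H' K' assume "H' \<in> reduce ` \<H>" "K' \<in> reduce ` \<H>"
  then show "linked ((\<lambda>B. B \<union> X' B) ` \<B>) (H' - K')" using linked_reduce by blast
qed

subsection \<open>Extending a support across the leaf bag\<close>

text \<open>The last clause of \<open>support_bags\<close> is applied to the reduced
  \<open>member S\<close> at \<open>rep S\<close>. A member \<open>H\<close> that contains
  \<open>S\<close> but not \<open>rep S\<close> contains all of \<open>member S\<close> outside
  \<open>D\<close>, and by minimality of \<open>S\<close> nothing else of the reduced
  \<open>member S\<close> remains besides \<open>rep S\<close>.\<close>

lemma link_vertex:
  assumes supp: "support_bags b t \<B> X' (reduce ` \<H>) \<C> f" and S: "S \<in> M"
  obtains w where "w \<in> f A" "w \<noteq> rep S"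
    "\<And>H. H \<in> \<H> \<Longrightarrow> S \<subseteq> H \<Longrightarrow> rep S \<notin> H \<Longrightarrow> w \<in> reduce H"
proof -
  note mem = member_props[OF S]
  have "rep S \<in> X' A" using S unfolding X'_def by simp
  moreover have "S \<subseteq> member S" using mem(2) by blast
  then have "rep S \<in> reduce (member S)" using rep_mem_reduce S mem by blast
  moreover have "b \<inter> reduce (member S) \<noteq> {rep S}"
  proof -
    obtain v where v: "v \<in> member S" "v \<in> b" "v \<notin> D" using mem(3) by blast
    then have "v \<in> reduce (member S)" "v \<noteq> rep S" using mem(5) unfolding reduce_def by auto
    then show ?thesis using v(2) by blast
  qed
  ultimately obtain w where w: "w \<in> f A" "w \<noteq> rep S"
    and link: "\<And>K. K \<in> reduce ` \<H> \<Longrightarrow> reduce (member S) - {rep S} \<subseteq> K \<Longrightarrow> rep S \<notin> K \<Longrightarrow> w \<in> K"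
    using support_bags_link[OF supp A _ imageI[OF mem(1)]] by blast
  have "w \<in> reduce H" if H: "H \<in> \<H>" "S \<subseteq> H" "rep S \<notin> H" for H
  proof (rule link)
    have "member S \<inter> A \<subseteq> H" using mem(2) H(2) by simp
    from diff_one_side[OF mem(1) H(1) this] have "member S - D \<subseteq> H"
      using H(3) mem(4,5) by blast
    then show "reduce (member S) - {rep S} \<subseteq> reduce H"
      using reduce_member_D[OF S] reduce_outside[of H] reduce_outside[of "member S"] by blast
  qed (use H reduce_subset[of H] in auto)
  then show thesis using that w by blast
qed

text \<open>At bags other than \<open>A\<close> and \<open>B\<close> the representatives are
  unchanged, so the linking vertices can be inherited from the reduced system. The difficulty is a
  set \<open>H\<close> whose reduction has no blue vertex besides \<open>u\<close>.\<close>

lemma link_outside: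
  assumes supp: "support_bags b t \<B> X' (reduce ` \<H>) \<C> f"
    and C: "C \<in> \<B>" "C \<noteq> A" and u: "u \<in> X C" and H: "H \<in> \<H>" "u \<in> H" "b \<inter> H \<noteq> {u}"
  obtains w where "w \<in> f C" "w \<noteq> u"
    "\<And>K. K \<in> \<H> \<Longrightarrow> H - {u} \<subseteq> K \<Longrightarrow> u \<notin> K \<Longrightarrow> w \<in> K"
proof -
  have uX': "u \<in> X' C" using u C unfolding X'_def by simp
  have uD: "u \<notin> D" and uA: "u \<notin> A" and ub: "u \<in> b"
    using D_disjoint_X[OF C] u X_props(3,4)[of C] C A by blast+
  have link: "\<exists>w\<in>f C. w \<noteq> u \<and> (\<forall>K\<in>\<H>. reduce L - {u} \<subseteq> reduce K \<and> u \<notin> K \<longrightarrow> w \<in> K)"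
    if L: "L \<in> \<H>" "u \<in> L" "b \<inter> reduce L \<noteq> {u}" for L
  proof -
    have "u \<in> reduce L" using L uD reduce_outside[of L] by blast
    then obtain w where w: "w \<in> f C" "w \<noteq> u"
      "\<And>K. K \<in> reduce ` \<H> \<Longrightarrow> reduce L - {u} \<subseteq> K \<Longrightarrow> u \<notin> K \<Longrightarrow> w \<in> K"
      using support_bags_link[OF supp C(1) uX' imageI[OF L(1)] _ L(3)] by blast
    then show ?thesis using reduce_subset by blast
  qed
  show thesis
  proof (cases "b \<inter> reduce H = {u}")
    case False
    have red: "reduce H - {u} \<subseteq> reduce K" if K: "K \<in> \<H>" "H - {u} \<subseteq> K" for K
    proof
      fix v assume v: "v \<in> reduce H - {u}"
      then have vK: "v \<in> K" using reduce_subset[of H] K by blast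
      show "v \<in> reduce K"
      proof (cases "v \<in> D")
        case False
        then show ?thesis using vK reduce_outside[of K] by blast
      next
        case True
        then obtain S where S: "S \<in> M" "S \<subseteq> H" "v = rep S"
          using v unfolding reduce_def by blast
        \<comment> \<open>\<open>S\<close> lies in \<open>A\<close> and \<open>u\<close> does not,
          so removing \<open>u\<close> from \<open>H\<close> loses nothing of
          \<open>S\<close>.\<close>
        then have "S \<subseteq> K" using K uA M_subset_Pow by blast
        then show ?thesis using rep_mem_reduce S vK by blast
      qed
    qed
    obtain w where w: "w \<in> f C" "w \<noteq> u"
      "\<forall>K\<in>\<H>. reduce H - {u} \<subseteq> reduce K \<and> u \<notin> K \<longrightarrow> w \<in> K"
      using link[OF H(1,2) False] by blast
    show thesis by (rule that[OF w(1,2)]) (use w(3) red in simp)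
  next
    case True
    \<comment> \<open>Here \<open>H\<close> is blue only in \<open>D\<close> and at \<open>u\<close>, and its reduction loses \<open>D\<close>; the chosen
      member with the same minimal trace takes over its role.\<close>
    have out: "H \<inter> b - D \<subseteq> {u}" using True reduce_outside[of H] by blast
    then have "H \<inter> D \<inter> b \<noteq> {}" using H ub by blast
    moreover have "H \<inter> b - (A \<union> D) \<noteq> {}" using H ub uA uD by blast
    ultimately obtain S where S: "S \<in> M" "S \<subseteq> H" using crossing_trace H(1) by blast
    note mem = member_props[OF S(1)]
    have repH: "rep S \<notin> H"
    proof
      assume "rep S \<in> H"
      then have "rep S \<in> b \<inter> reduce H" using rep_mem_reduce[OF S] mem(6) by blast
      then show False using True mem(5) uD by simp
    qed
    have "member S \<inter> A \<subseteq> H" using mem(2) S(2) by simp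
    from diff_one_side[OF mem(1) H(1) this] have memH: "member S - D \<subseteq> H"
      using repH mem(4,5) by blast
    \<comment> \<open>The blue vertex of \<open>member S\<close> beyond \<open>A\<close> lies in
      \<open>H\<close>, whose only blue vertex outside \<open>D\<close> is \<open>u\<close>.\<close>
    then have u_mem: "u \<in> member S" using mem(3) out by blast
    have "rep S \<in> reduce (member S)" using rep_mem_reduce[OF S(1) _ mem(4)] mem(2) by blast
    then have ne: "b \<inter> reduce (member S) \<noteq> {u}" using mem(5,6) uD by (metis IntI singletonD)
    have red: "reduce (member S) - {u} \<subseteq> reduce K"
      if K: "K \<in> \<H>" "H - {u} \<subseteq> K" "u \<notin> K" for K
    proof -
      have SK: "S \<subseteq> K" using S K uA M_subset_Pow by blast
      then have "member S \<inter> A \<subseteq> K" using mem(2) by simp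
      \<comment> \<open>\<open>K\<close> misses \<open>u\<close>, a vertex of
        \<open>member S\<close> outside \<open>D\<close>, so it must contain all of
        \<open>member S\<close> inside \<open>D\<close>.\<close>
      from diff_one_side[OF mem(1) K(1) this] have "member S \<inter> D \<subseteq> K"
        using u_mem uD K(3) by blast
      then have repK: "rep S \<in> reduce K" using rep_mem_reduce[OF S(1) SK] mem(4,5) by blast
      have "reduce (member S) \<inter> D \<subseteq> reduce K" using reduce_member_D[OF S(1)] repK by simp
      moreover have "reduce (member S) - D - {u} \<subseteq> reduce K"
        unfolding reduce_outside using memH K(2) unfolding reduce_def by blast
      ultimately show ?thesis by blast
    qed
    obtain w where w: "w \<in> f C" "w \<noteq> u"
      "\<forall>K\<in>\<H>. reduce (member S) - {u} \<subseteq> reduce K \<and> u \<notin> K \<longrightarrow> w \<in> K"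
      using link[OF mem(1) u_mem ne] by blast
    show thesis by (rule that[OF w(1,2)]) (use w(3) red in simp)
  qed
qed

text \<open>The new bag \<open>Z\<close> is attached at \<open>f A\<close>. Blue vertices lost by
  the reduction of \<open>H\<close> all lie in \<open>Z\<close>, so a nonempty blue rest only has to
  meet \<open>Z\<close>: some \<open>rep S\<close> or \<open>w S\<close> ensures this when
  \<open>H\<close> crosses \<open>A\<close>.\<close>

lemma support_bags_extend:
  assumes supp: "support_bags b t \<B> X' (reduce ` \<H>) \<C> f"
  shows "\<exists>\<C> f. support_bags b t (insert B \<B>) X \<H> \<C> f"
proof -
  have "\<exists>w. \<forall>S\<in>M. w S \<in> f A \<and> w S \<noteq> rep S \<and>
      (\<forall>H\<in>\<H>. S \<subseteq> H \<and> rep S \<notin> H \<longrightarrow> w S \<in> reduce H)"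
  proof (rule bchoice, rule ballI)
    fix S assume "S \<in> M"
    then obtain v where "v \<in> f A" "v \<noteq> rep S"
      "\<And>H. H \<in> \<H> \<Longrightarrow> S \<subseteq> H \<Longrightarrow> rep S \<notin> H \<Longrightarrow> v \<in> reduce H"
      using link_vertex[OF supp] by metis
    then show "\<exists>v. v \<in> f A \<and> v \<noteq> rep S \<and> (\<forall>H\<in>\<H>. S \<subseteq> H \<and> rep S \<notin> H \<longrightarrow> v \<in> reduce H)"
      by blast
  qed
  then obtain w where "\<forall>S\<in>M. w S \<in> f A \<and> w S \<noteq> rep S \<and>
      (\<forall>H\<in>\<H>. S \<subseteq> H \<and> rep S \<notin> H \<longrightarrow> w S \<in> reduce H)"
    by (elim exE)
  then have w: "\<And>S. S \<in> M \<Longrightarrow> w S \<in> f A" "\<And>S. S \<in> M \<Longrightarrow> w S \<noteq> rep S"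
    "\<And>S H. S \<in> M \<Longrightarrow> H \<in> \<H> \<Longrightarrow> S \<subseteq> H \<Longrightarrow> rep S \<notin> H \<Longrightarrow> w S \<in> reduce H"
    by simp_all
  \<comment> \<open>This is \<open>b \<inter> (A \<union> D)\<close> together with the linking
    vertices.\<close>
  define Z where "Z = b \<inter> (A \<union> B) \<union> X A \<union> X B \<union> w ` M"
  \<comment> \<open>Both \<open>A\<close> and \<open>B\<close> are assigned to \<open>Z\<close>, as
    \<open>f A\<close> need not contain the representatives \<open>X A\<close> and
    \<open>X B\<close>.\<close>
  define g where "g C = (if C = A \<or> C = B then Z else f C)" for C
  have tb: "tree_bags \<C>" and cardC: "\<And>C. C \<in> \<C> \<Longrightarrow> finite C \<and> card C \<le> 2 ^ (t + 2) + t + 1"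
    and UC: "\<Union>\<C> = b \<inter> (\<Union>C\<in>\<B>. C \<union> X' C)"
    and f: "\<And>C. C \<in> \<B> \<Longrightarrow> f C \<in> \<C> \<and> b \<inter> C \<subseteq> f C \<and> X' C \<subseteq> f C"
    and lk: "\<And>H. H \<in> \<H> \<Longrightarrow> linked \<C> (b \<inter> reduce H)"
    using supp unfolding support_bags_def by auto
  have Xb: "X A \<subseteq> b" "X B \<subseteq> b" using X_props(3) A by blast+
  have rZ: "b \<inter> (A \<union> D) \<subseteq> Z" unfolding Z_def D_def by blast
  have X'A: "X' A = rep ` M" unfolding X'_def by simp
  \<comment> \<open>The old bags know \<open>D\<close> only through the representatives. These, the
    blue part of \<open>A\<close> and the vertices \<open>w S\<close> all lie in \<open>f A\<close>,
    which gives the tree condition for \<open>Z\<close>.\<close>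
  have D_C: "D \<inter> \<Union>\<C> \<subseteq> rep ` M"
  proof
    fix v assume v: "v \<in> D \<inter> \<Union>\<C>"
    then obtain C where C: "C \<in> \<B>" "v \<in> C \<union> X' C" using UC by blast
    then have "v \<in> X' C" using v D_disjoint by blast
    then show "v \<in> rep ` M" using v D_disjoint_X[OF C(1)] unfolding X'_def by (auto split: if_splits)
  qed
  have attach: "Z \<inter> \<Union>\<C> \<subseteq> f A"
  proof -
    have "Z \<subseteq> (b \<inter> A) \<union> D \<union> w ` M" unfolding Z_def D_def by blast
    then show ?thesis using D_C f[OF A] w(1) X'A by blast
  qed
  have cardZ: "finite Z \<and> card Z \<le> 2 ^ (t + 2) + t + 1"
  proof
    have XA: "finite (X A)" "card (X A) \<le> 2 ^ t" and XB: "finite (X B)" "card (X B) \<le> 2 ^ t"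
      using X_props(1,2) A by blast+
    show "finite Z" unfolding Z_def using finite_A XA XB finite_M by simp
    have "card (b \<inter> (A \<union> B)) \<le> card (A \<union> B)" by (rule card_mono) (use finite_A in auto)
    also have "\<dots> \<le> 2 * Suc t" using card_Un_le[of A B] finite_A(3,4) by simp
    finally have 1: "card (b \<inter> (A \<union> B)) \<le> 2 * Suc t" .
    have 2: "card (w ` M) \<le> 2 ^ t" using card_image_le[OF finite_M, of w] card_M by linarith
    have "card Z \<le> card (b \<inter> (A \<union> B)) + card (X A) + card (X B) + card (w ` M)"
      unfolding Z_def
      using card_Un_le[of "b \<inter> (A \<union> B) \<union> X A \<union> X B" "w ` M"]
        card_Un_le[of "b \<inter> (A \<union> B) \<union> X A" "X B"] card_Un_le[of "b \<inter> (A \<union> B)" "X A"]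
      by linarith
    also have "\<dots> \<le> 2 * Suc t + 3 * 2 ^ t" using 1 2 XA XB by linarith
    \<comment> \<open>After cancelling, the inequality is \<open>t + 1 \<le> 2 ^ t\<close>.\<close>
    also have "\<dots> \<le> 2 ^ (t + 2) + t + 1" using less_exp[of t] by (simp add: Suc_le_eq)
    finally show "card Z \<le> 2 ^ (t + 2) + t + 1" .
  qed
  have union: "\<Union>(insert Z \<C>) = b \<inter> (\<Union>C\<in>insert B \<B>. C \<union> X C)"
  proof (intro equalityI subsetI)
    fix v assume "v \<in> \<Union>(insert Z \<C>)"
    moreover have "w ` M \<subseteq> \<Union>\<C>" using w(1) f[OF A] by blast
    ultimately consider "v \<in> b \<inter> (A \<union> B) \<union> X A \<union> X B" | "v \<in> \<Union>\<C>"
      unfolding Z_def by blast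
    then show "v \<in> b \<inter> (\<Union>C\<in>insert B \<B>. C \<union> X C)"
    proof cases
      case 1
      then show ?thesis using A Xb by blast
    next
      case 2
      then obtain C where C: "v \<in> b" "C \<in> \<B>" "v \<in> C \<union> X' C" using UC by blast
      show ?thesis
      proof (cases "C = A \<and> v \<in> X' A")
        case True
        then have "v \<in> D" using X'A member_props(5) by auto
        then show ?thesis using C A unfolding D_def by blast
      next
        case False
        then show ?thesis using C unfolding X'_def by (auto split: if_splits)
      qed
    qed
  next
    fix v assume "v \<in> b \<inter> (\<Union>C\<in>insert B \<B>. C \<union> X C)"
    then obtain C where C: "v \<in> b" "C \<in> insert B \<B>" "v \<in> C \<union> X C" by blast
    show "v \<in> \<Union>(insert Z \<C>)"
    proof (cases "C = A \<or> C = B")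
      case True
      then show ?thesis using C unfolding Z_def by blast
    next
      case False
      then have "C \<in> \<B>" "v \<in> C \<union> X' C" using C unfolding X'_def by auto
      then show ?thesis using C UC by blast
    qed
  qed
  have linkedZ: "linked (insert Z \<C>) (b \<inter> H)" if H: "H \<in> \<H>" for H
  proof (rule linkedI)
    fix Y assume Y: "Y \<subseteq> b \<inter> H" "Y \<noteq> {}" "Y \<noteq> b \<inter> H"
      and neg: "\<And>C. C \<in> insert Z \<C> \<Longrightarrow> C \<inter> Y = {} \<or> C \<inter> (b \<inter> H - Y) = {}"
    show False
    proof -
      have notZ: "Z \<inter> Y = {} \<or> Z \<inter> (b \<inter> H - Y) = {}" by (rule neg) simp
      have red: "b \<inter> reduce H \<subseteq> b \<inter> H" using reduce_subset by blast
      have rest: "b \<inter> H - reduce H \<subseteq> b \<inter> H \<inter> D" using reduce_outside[of H] by blast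
      \<comment> \<open>The blue part of the reduced set is already linked by the old bags, so it
        cannot be split.\<close>
      have one: "b \<inter> reduce H \<subseteq> Y \<or> b \<inter> reduce H \<inter> Y = {}"
      proof (rule ccontr)
        assume no: "\<not> ?thesis"
        have "(b \<inter> reduce H) \<inter> Y = b \<inter> reduce H"
        proof (rule linkedD[OF lk[OF H]])
          fix C assume "C \<in> \<C>" "C \<inter> (b \<inter> reduce H \<inter> Y) \<noteq> {}"
          then have "C \<inter> (b \<inter> H - Y) = {}" using neg[of C] by blast
          then show "C \<inter> (b \<inter> reduce H - b \<inter> reduce H \<inter> Y) = {}" using red by blast
        qed (use no in auto)
        then show False using no by blast
      qed
      have HDZ: "b \<inter> H \<inter> D \<subseteq> Z" using rZ by blast
      have D_ne: "b \<inter> H \<inter> D \<noteq> {}" and red_ne: "b \<inter> reduce H \<noteq> {}"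
      proof -
        show "b \<inter> H \<inter> D \<noteq> {}" using one rest Y red by blast
        show "b \<inter> reduce H \<noteq> {}" using notZ rest HDZ Y by blast
      qed
      have "b \<inter> reduce H \<inter> Z \<noteq> {}"
      proof (cases "H \<inter> b - (A \<union> D) = {}")
        case True
        then show ?thesis using red_ne reduce_subset[of H] rZ by blast
      next
        case False
        then obtain S where S: "S \<in> M" "S \<subseteq> H" using crossing_trace[OF H] D_ne by blast
        show ?thesis
        proof (cases "rep S \<in> H")
          case True
          then show ?thesis using rep_mem_reduce[OF S] member_props(5,6)[OF S(1)] rZ by blast
        next
          case False
          then have "w S \<in> reduce H" using w(3) S H by blast
          moreover have "w S \<in> b" using w(1)[OF S(1)] f[OF A] UC by blast
          moreover have "w S \<in> Z" using S unfolding Z_def by blast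
          ultimately show ?thesis by blast
        qed
      qed
      then obtain z where z: "z \<in> b \<inter> reduce H" "z \<in> Z" by blast
      have cover: "b \<inter> H \<subseteq> (b \<inter> reduce H) \<union> Z" using rest HDZ by blast
      from one show False
      proof
        assume "b \<inter> reduce H \<subseteq> Y"
        moreover from this have "Z \<inter> (b \<inter> H - Y) = {}" using notZ z by blast
        ultimately have "b \<inter> H \<subseteq> Y" using cover by blast
        then show False using Y by simp
      next
        assume "b \<inter> reduce H \<inter> Y = {}"
        moreover from this have "Z \<inter> Y = {}" using notZ z red by blast
        ultimately have "Y = {}" using cover Y(1) by blast
        then show False using Y by simp
      qed
    qed
  qed
  have link: "\<exists>v\<in>g C. v \<noteq> u \<and> (\<forall>K\<in>\<H>. H - {u} \<subseteq> K \<and> u \<notin> K \<longrightarrow> v \<in> K)"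
    if C: "C \<in> insert B \<B>" and u: "u \<in> X C" and H: "H \<in> \<H>" "u \<in> H" "b \<inter> H \<noteq> {u}" for C u H
  proof (cases "C = A \<or> C = B")
    case False
    then show ?thesis using link_outside[OF supp _ _ u H] C unfolding g_def by (metis insertE)
  next
    case True
    then have uD: "u \<in> D" "u \<in> b" using u Xb unfolding D_def by blast+
    have gC: "g C = Z" using True unfolding g_def by simp
    show ?thesis
    \<comment> \<open>A second blue vertex of \<open>H\<close> in \<open>A \<union> D\<close> is in
      \<open>Z\<close> and serves as the link. Otherwise \<open>H\<close> crosses \<open>A\<close>
      and contains some \<open>S\<close>, which supplies \<open>w S\<close> or
      \<open>rep S\<close>.\<close>
    proof (cases "b \<inter> H \<inter> (A \<union> D) = {u}")
      case False
      then obtain v where v: "v \<in> b \<inter> H \<inter> (A \<union> D)" "v \<noteq> u" using uD H by blast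
      then have "v \<in> Z" using rZ by blast
      then show ?thesis unfolding gC
        by (intro bexI[of _ v] conjI ballI impI) (use v in auto)
    next
      case only: True
      then have "H \<inter> b - (A \<union> D) \<noteq> {}" using H by blast
      then obtain S where S: "S \<in> M" "S \<subseteq> H" using crossing_trace[OF H(1)] uD H by blast
      note mem = member_props[OF S(1)]
      have SK: "S \<subseteq> K" if "H - {u} \<subseteq> K" for K
        using that S M_subset_Pow A_D uD by blast
      have wZ: "w S \<in> Z" using S unfolding Z_def by blast
      have repZ: "rep S \<in> Z" using mem rZ by blast
      show ?thesis
      proof (cases "rep S \<in> H")
        case True
        then have "rep S = u" using only mem(5,6) by blast
        show ?thesis unfolding gC
        proof (intro bexI[OF _ wZ] conjI ballI impI)
          show "w S \<noteq> u" using w(2)[OF S(1)] \<open>rep S = u\<close> by simp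
          fix K assume K: "K \<in> \<H>" "H - {u} \<subseteq> K \<and> u \<notin> K"
          then have "w S \<in> reduce K" using w(3)[OF S(1) K(1) SK] \<open>rep S = u\<close> by simp
          then show "w S \<in> K" using reduce_subset by blast
        qed
      next
        case repH: False
        then have wH: "w S \<in> H" using w(3)[OF S(1) H(1) S(2)] reduce_subset by blast
        show ?thesis
        \<comment> \<open>If \<open>w S\<close> is \<open>u\<close> itself, the roles swap: a set
          containing \<open>S\<close> but not \<open>w S\<close> must contain
          \<open>rep S\<close>.\<close>
        proof (cases "w S = u")
          case True
          show ?thesis unfolding gC
          proof (intro bexI[OF _ repZ] conjI ballI impI)
            show "rep S \<noteq> u" using repH H(2) by blast
            fix K assume K: "K \<in> \<H>" "H - {u} \<subseteq> K \<and> u \<notin> K"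
            show "rep S \<in> K"
              using w(3)[OF S(1) K(1) SK] K(2) True reduce_subset[of K] by blast
          qed
        next
          case False
          show ?thesis unfolding gC
            by (intro bexI[OF _ wZ] conjI ballI impI) (use False wH in auto)
        qed
      qed
    qed
  qed
  have "support_bags b t (insert B \<B>) X \<H> (insert Z \<C>) g"
    unfolding support_bags_def
  proof (intro conjI)
    show "tree_bags (insert Z \<C>)" using tree_bags.insert[OF tb _ attach] f[OF A] by blast
    show "\<forall>C\<in>insert Z \<C>. finite C \<and> card C \<le> 2 ^ (t + 2) + t + 1" using cardC cardZ by blast
    show "\<forall>C\<in>insert B \<B>. g C \<in> insert Z \<C> \<and> b \<inter> C \<subseteq> g C \<and> X C \<subseteq> g C"
    proof
      fix C assume C: "C \<in> insert B \<B>"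
      show "g C \<in> insert Z \<C> \<and> b \<inter> C \<subseteq> g C \<and> X C \<subseteq> g C"
      proof (cases "C = A \<or> C = B")
        case True
        then have "g C = Z" unfolding g_def by simp
        then show ?thesis using True unfolding Z_def by blast
      next
        case False
        then have "g C = f C" "X' C = X C" "C \<in> \<B>" using C unfolding g_def X'_def by auto
        then show ?thesis using f[of C] by auto
      qed
    qed
    show "\<Union>(insert Z \<C>) = b \<inter> (\<Union>C\<in>insert B \<B>. C \<union> X C)" by (rule union)
    show "\<forall>H\<in>\<H>. linked (insert Z \<C>) (b \<inter> H)" by (intro ballI linkedZ)
    show "\<forall>C\<in>insert B \<B>. \<forall>u\<in>X C. \<forall>H\<in>\<H>. u \<in> H \<and> b \<inter> H \<noteq> {u} \<longrightarrow>
        (\<exists>w\<in>g C. w \<noteq> u \<and> (\<forall>K\<in>\<H>. H - {u} \<subseteq> K \<and> u \<notin> K \<longrightarrow> w \<in> K))"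
      by (intro ballI impI, elim conjE) (rule link)
  qed
  then show ?thesis by blast
qed

end

section \<open>The induction over the bags, and the theorem\<close>

text \<open>Induction over the construction of the bags, with \<open>X\<close> and
  \<open>\<H>\<close> arbitrary because reduction changes both. With a single bag, all blue vertices
  form one bag.\<close>

lemma support_bags_exist:
  assumes "tree_bags \<B>" and "bag_system b t \<B> X \<H>"
  shows "\<exists>\<C> f. support_bags b t \<B> X \<H> \<C> f"
  using assms
proof (induction arbitrary: X \<H>)
  case (single A)
  let ?Z = "(b \<inter> A) \<union> X A"
  have A: "finite A" "card A \<le> Suc t" "finite (X A)" "card (X A) \<le> 2 ^ t" "X A \<subseteq> b"
    and sub: "\<And>H. H \<in> \<H> \<Longrightarrow> H \<subseteq> A \<union> X A"
    using single unfolding bag_system_def by auto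
  have "card (b \<inter> A) \<le> card A" by (rule card_mono) (use A in auto)
  then have "card ?Z \<le> Suc t + 2 ^ t" using A card_Un_le[of "b \<inter> A" "X A"] by linarith
  also have "\<dots> \<le> 2 ^ (t + 2) + t + 1" by simp
  finally have card: "card ?Z \<le> 2 ^ (t + 2) + t + 1" .
  have "support_bags b t {A} X \<H> {?Z} (\<lambda>_. ?Z)"
    unfolding support_bags_def
  proof (intro conjI)
    show "tree_bags {?Z}" by (rule tree_bags.single)
    show "\<forall>C\<in>{?Z}. finite C \<and> card C \<le> 2 ^ (t + 2) + t + 1" using card A by simp
    show "\<Union>{?Z} = b \<inter> (\<Union>B\<in>{A}. B \<union> X B)" using A by auto
    show "\<forall>H\<in>\<H>. linked {?Z} (b \<inter> H)"
    proof (intro ballI linkedI)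
      fix H Y assume H: "H \<in> \<H>" and Y: "Y \<subseteq> b \<inter> H" "Y \<noteq> {}" "Y \<noteq> b \<inter> H"
        and split: "\<And>C. C \<in> {?Z} \<Longrightarrow> C \<inter> Y = {} \<or> C \<inter> (b \<inter> H - Y) = {}"
      have "b \<inter> H \<subseteq> ?Z" using sub[OF H] by blast
      then show False using split[of ?Z] Y by blast
    qed
    show "\<forall>B\<in>{A}. \<forall>u\<in>X B. \<forall>H\<in>\<H>. u \<in> H \<and> b \<inter> H \<noteq> {u} \<longrightarrow>
        (\<exists>w\<in>?Z. w \<noteq> u \<and> (\<forall>K\<in>\<H>. H - {u} \<subseteq> K \<and> u \<notin> K \<longrightarrow> w \<in> K))"
    proof (intro ballI impI, elim conjE)
      fix B u H assume "B \<in> {A}" "u \<in> X B" "H \<in> \<H>" "u \<in> H" "b \<inter> H \<noteq> {u}"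
      then obtain v where v: "v \<in> b \<inter> H" "v \<noteq> u" using A(5) by blast
      then have "v \<in> ?Z" using sub[OF \<open>H \<in> \<H>\<close>] by blast
      then show "\<exists>w\<in>?Z. w \<noteq> u \<and> (\<forall>K\<in>\<H>. H - {u} \<subseteq> K \<and> u \<notin> K \<longrightarrow> w \<in> K)"
        by (intro bexI[of _ v] conjI ballI impI) (use v in auto)
    qed
  qed auto
  then show ?case by blast
next
  case (insert \<B> A B)
  show ?case
  \<comment> \<open>\<open>tree_bags\<close> allows a bag to be inserted again, which changes
    nothing.\<close>
  proof (cases "B \<in> \<B>")
    case True
    then show ?thesis using insert by (simp add: insert_absorb)
  next
    case False
    then interpret leaf_bag b t \<B> X \<H> A B
      using insert by unfold_locales
    show ?thesis using insert.IH[OF bag_system_reduce] support_bags_extend by blast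
  qed
qed

theorem mainTheorem1:
  fixes V :: "'a set" and E :: "'a set set" and c :: "'a \<Rightarrow> colour"
    and \<H> :: "'a set set" and t :: nat
  assumes "simple_graph V E"
    and "treewidth V E = t"
    and "non_piercing E V \<H>"
  shows "\<exists>EQ. primal_support V c \<H> EQ
           \<and> treewidth (blue_part c V) EQ \<le> 2 ^ (t + 2) + t"
proof -
  have fin: "finite V" and sub: "\<And>e. e \<in> E \<Longrightarrow> e \<subseteq> V"
    using assms(1) unfolding simple_graph_def by auto
  \<comment> \<open>The one-bag decomposition shows that the minimum defining
    \<open>treewidth\<close> is attained.\<close>
  have "tree_decomposition V E {0} {} (\<lambda>_. V)"
    using sub unfolding tree_decomposition_def is_tree_def simple_graph_def connected_in_def
    by auto
  then have "has_treewidth_le V E (card V)" unfolding has_treewidth_le_def by force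
  then have "has_treewidth_le V E t" using assms(2) LeastI unfolding treewidth_def by metis
  then obtain N TE B where td: "tree_decomposition V E N TE B"
    and card: "\<And>i. i \<in> N \<Longrightarrow> card (B i) \<le> Suc t"
    unfolding has_treewidth_le_def by auto
  have tree: "is_tree N TE" and V: "(\<Union>i\<in>N. B i) = V"
    and edges: "\<forall>e\<in>E. \<exists>C\<in>B ` N. e \<subseteq> C"
    and conn: "\<And>v. v \<in> V \<Longrightarrow> connected_in TE {i \<in> N. v \<in> B i}"
    using td unfolding tree_decomposition_def by auto
  have "connected_in TE {i \<in> N. v \<in> B i}" for v
  proof (cases "v \<in> V")
    case False
    then show ?thesis using V unfolding connected_in_def by blast
  qed (rule conn)
  then have bags: "tree_bags (B ` N)" by (rule tree_bags_if_tree[OF tree])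
  define b where "b = {v. c v = Blue}"
  have H: "H \<subseteq> V" if "H \<in> \<H>" for H
    using assms(3) that unfolding non_piercing_def by blast
  have diff: "connected_in E (H - K)" if "H \<in> insert {} \<H>" "K \<in> insert {} \<H>" for H K
  proof -
    have "connected_in E {}" unfolding connected_in_def by simp
    then show ?thesis using assms(3) that unfolding non_piercing_def by auto
  qed
  \<comment> \<open>Nothing has been cut off at the start, so there are no representatives.\<close>
  have "bag_system b t (B ` N) (\<lambda>_. {}) (insert {} \<H>)"
    unfolding bag_system_def
  proof (intro conjI)
    show "\<forall>C\<in>B ` N. finite C \<and> card C \<le> Suc t"
      using card V fin by (auto intro: finite_subset)
    show "\<forall>H\<in>insert {} \<H>. \<forall>K\<in>insert {} \<H>. linked ((\<lambda>C. C \<union> {}) ` B ` N) (H - K)"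
      using linked_if_connected_in[OF diff edges] by simp
    show "\<forall>H\<in>insert {} \<H>. H \<subseteq> (\<Union>C\<in>B ` N. C \<union> {})" using H V by auto
  qed auto
  from support_bags_exist[OF bags this] obtain \<C> f
    where supp: "support_bags b t (B ` N) (\<lambda>_. {}) (insert {} \<H>) \<C> f" by blast
  have tC: "tree_bags \<C>" and cardC: "\<And>C. C \<in> \<C> \<Longrightarrow> card C \<le> 2 ^ (t + 2) + t + 1"
    and UC: "\<Union>\<C> = b \<inter> V" and lk: "\<And>H. H \<in> \<H> \<Longrightarrow> linked \<C> (b \<inter> H)"
    using supp V unfolding support_bags_def by auto
  have blue: "blue_part c S = b \<inter> S" for S unfolding blue_part_def b_def by auto
  let ?EQ = "bag_graph \<C>"
  have "primal_support V c \<H> ?EQ"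
    unfolding primal_support_def simple_graph_def blue
  proof (intro conjI ballI)
    show "finite (b \<inter> V)" using fin by simp
    show "connected_in ?EQ (b \<inter> H)" if "H \<in> \<H>" for H
      using connected_in_bag_graph[OF lk[OF that]] .
    show "\<exists>u v. e = {u, v} \<and> u \<noteq> v \<and> u \<in> b \<inter> V \<and> v \<in> b \<inter> V" if "e \<in> ?EQ" for e
      using that unfolding bag_graph_def UC[symmetric] by blast
  qed
  \<comment> \<open>The bags have at most \<open>2 ^ (t + 2) + t + 1\<close> vertices, one more than
    the width.\<close>
  moreover have "has_treewidth_le (b \<inter> V) ?EQ (2 ^ (t + 2) + t)"
  proof -
    obtain N' TE' B' where T': "is_tree N' TE'" "B' ` N' = \<C>"
      "\<And>v. connected_in TE' {i \<in> N'. v \<in> B' i}"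
      using tree_if_tree_bags[OF tC] by blast
    have "\<exists>i\<in>N'. e \<subseteq> B' i" if "e \<in> ?EQ" for e
      using that unfolding bag_graph_def T'(2)[symmetric] by blast
    then have "tree_decomposition (b \<inter> V) ?EQ N' TE' B'"
      using T' UC unfolding tree_decomposition_def by blast
    moreover have "\<forall>i\<in>N'. card (B' i) \<le> 2 ^ (t + 2) + t + 1" using cardC T'(2) by blast
    ultimately show ?thesis unfolding has_treewidth_le_def by blast
  qed
  then have "treewidth (blue_part c V) ?EQ \<le> 2 ^ (t + 2) + t"
    unfolding treewidth_def blue by (rule Least_le)
  ultimately show ?thesis by blast
qed

end
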